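(* Let $M=(E,\rho)$ be a simple binary matroid that contains no isthmuses. Then the lattice of cyclic flats $\mathcal{Z}(M)$ is atomic, i.e. every element of $\mathcal{Z}(M)$ is a join of atoms.
   Context: A matroid is binary if it is representable over $\mathbb{F}_2$; simple means it has no loops and no parallel elements; an isthmus (coloop) is an element $e$ with $\rho(E-e)<\rho(E)$. A cyclic flat is a set $X$ with $\mathrm{cl}(X)=X$ and $\mathrm{cyc}(X)=X$, where $\mathrm{cl}(X)=\{e:\rho(X\cup e)=\rho(X)\}$ and $\mathrm{cyc}(X)=\{e\in X:\rho(X-e)=\rho(X)\}$. $\mathcal{Z}(M)$ is the lattice of cyclic flats under inclusion, with join $X\vee Y=\mathrm{cl}(X\cup Y)$ and meet $X\wedge Y=\mathrm{cyc}(X\cap Y)$; an atom is an element covering the bottom element. *)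

theory Defs
  imports
    HOL.Vector_Spaces
    "HOL-Algebra.Complete_Lattice"
    "HOL-Library.Function_Algebras"
    "HOL-Library.Z2"
begin

section \<open>Atoms and atomic lattices\<close>

definition covers :: "[_, 'a, 'a] \<Rightarrow> bool" where
  "covers L x y \<longleftrightarrow> x \<in> carrier L \<and> y \<in> carrier L \<and> x \<sqsubset>\<^bsub>L\<^esub> y \<and>
     \<not> (\<exists>z\<in>carrier L. x \<sqsubset>\<^bsub>L\<^esub> z \<and> z \<sqsubset>\<^bsub>L\<^esub> y)"

definition atoms :: "_ \<Rightarrow> 'a set" where
  "atoms L = {a. covers L \<bottom>\<^bsub>L\<^esub> a}"

text \<open>This is what is often called an atomistic lattice. The empty set of atoms is allowed;
  its join is the bottom element.\<close>

definition atomic_lattice :: "_ \<Rightarrow> bool" where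
  "atomic_lattice L \<longleftrightarrow> (\<forall>x\<in>carrier L. \<exists>A\<subseteq>atoms L. x = \<Squnion>\<^bsub>L\<^esub>A)"


section \<open>Matroids given by a rank function\<close>

text \<open>Only the values of \<open>\<rho>\<close> on subsets of \<open>E\<close> matter.\<close>

locale matroid =
  fixes E :: "'a set" and \<rho> :: "'a set \<Rightarrow> nat"
  assumes finite_ground: "finite E"
    and rank_le_card: "X \<subseteq> E \<Longrightarrow> \<rho> X \<le> card X"
    and rank_mono: "X \<subseteq> Y \<Longrightarrow> Y \<subseteq> E \<Longrightarrow> \<rho> X \<le> \<rho> Y"
    and rank_submodular:
      "X \<subseteq> E \<Longrightarrow> Y \<subseteq> E \<Longrightarrow> \<rho> (X \<union> Y) + \<rho> (X \<inter> Y) \<le> \<rho> X + \<rho> Y"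

definition loop :: "'a set \<Rightarrow> ('a set \<Rightarrow> nat) \<Rightarrow> 'a \<Rightarrow> bool" where
  "loop E \<rho> e \<longleftrightarrow> e \<in> E \<and> \<rho> {e} = 0"

definition parallel :: "'a set \<Rightarrow> ('a set \<Rightarrow> nat) \<Rightarrow> 'a \<Rightarrow> 'a \<Rightarrow> bool" where
  "parallel E \<rho> e f \<longleftrightarrow> e \<in> E \<and> f \<in> E \<and> e \<noteq> f \<and>
     \<not> loop E \<rho> e \<and> \<not> loop E \<rho> f \<and> \<rho> {e, f} = 1"

definition simple_matroid :: "'a set \<Rightarrow> ('a set \<Rightarrow> nat) \<Rightarrow> bool" where
  "simple_matroid E \<rho> \<longleftrightarrow> (\<nexists>e. loop E \<rho> e) \<and> (\<nexists>e f. parallel E \<rho> e f)"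

definition isthmus :: "'a set \<Rightarrow> ('a set \<Rightarrow> nat) \<Rightarrow> 'a \<Rightarrow> bool" where
  "isthmus E \<rho> e \<longleftrightarrow> e \<in> E \<and> \<rho> (E - {e}) < \<rho> E"

text \<open>Since the dimension \<open>n\<close> is existentially quantified, the space \<open>'k\<^sup>n\<close> is
  taken to consist of the functions \<open>nat \<Rightarrow> 'k\<close> that vanish from \<open>n\<close> on; \<open>v e\<close> is
  the column indexed by \<open>e\<close> of a representing matrix with \<open>n\<close> rows.\<close>

definition fun_scale :: "'k::field \<Rightarrow> (nat \<Rightarrow> 'k) \<Rightarrow> nat \<Rightarrow> 'k" where
  "fun_scale c x = (\<lambda>i. c * x i)"

lemma vector_space_fun_scale: "vector_space fun_scale"
  by unfold_locales (auto simp: fun_scale_def fun_eq_iff algebra_simps)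

definition representable_over :: "'k::field itself \<Rightarrow> 'a set \<Rightarrow> ('a set \<Rightarrow> nat) \<Rightarrow> bool" where
  "representable_over K E \<rho> \<longleftrightarrow>
     (\<exists>(n::nat) (v :: 'a \<Rightarrow> nat \<Rightarrow> 'k).
        (\<forall>e\<in>E. \<forall>i\<ge>n. v e i = 0) \<and>
        (\<forall>X\<subseteq>E. \<rho> X = vector_space.dim fun_scale (v ` X)))"

definition binary_matroid :: "'a set \<Rightarrow> ('a set \<Rightarrow> nat) \<Rightarrow> bool" where
  "binary_matroid E \<rho> \<longleftrightarrow> representable_over TYPE(bit) E \<rho>"


section \<open>Cyclic flats\<close>

definition cl :: "'a set \<Rightarrow> ('a set \<Rightarrow> nat) \<Rightarrow> 'a set \<Rightarrow> 'a set" where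
  "cl E \<rho> X = {e \<in> E. \<rho> (insert e X) = \<rho> X}"

definition cyc :: "('a set \<Rightarrow> nat) \<Rightarrow> 'a set \<Rightarrow> 'a set" where
  "cyc \<rho> X = {e \<in> X. \<rho> (X - {e}) = \<rho> X}"

definition cyclic_flat :: "'a set \<Rightarrow> ('a set \<Rightarrow> nat) \<Rightarrow> 'a set \<Rightarrow> bool" where
  "cyclic_flat E \<rho> X \<longleftrightarrow> X \<subseteq> E \<and> cl E \<rho> X = X \<and> cyc \<rho> X = X"

definition cyclic_flats :: "'a set \<Rightarrow> ('a set \<Rightarrow> nat) \<Rightarrow> 'a set gorder" where
  "cyclic_flats E \<rho> = \<lparr>carrier = {X. cyclic_flat E \<rho> X}, eq = (=), le = (\<subseteq>)\<rparr>"

text \<open>The rest of this section shows that the order-theoretic operations on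
  \<open>cyclic_flats E \<rho>\<close> are the usual matroidal ones.\<close>

context matroid
begin

lemma cl_subset: "cl E \<rho> X \<subseteq> E"
  by (auto simp: cl_def)

lemma subset_cl: "X \<subseteq> E \<Longrightarrow> X \<subseteq> cl E \<rho> X"
  by (auto simp: cl_def insert_absorb)

lemma cl_mono:
  assumes "X \<subseteq> Y" "Y \<subseteq> E" shows "cl E \<rho> X \<subseteq> cl E \<rho> Y"
proof
  fix e assume e: "e \<in> cl E \<rho> X"
  then have eE: "e \<in> E" and r: "\<rho> (insert e X) = \<rho> X" by (auto simp: cl_def)
  show "e \<in> cl E \<rho> Y"
  proof (cases "e \<in> Y")
    case True then show ?thesis using assms subset_cl by blast
  next
    case False
    have "insert e X \<union> Y = insert e Y" "insert e X \<inter> Y = X" using assms False by auto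
    then have "\<rho> (insert e Y) + \<rho> X \<le> \<rho> (insert e X) + \<rho> Y"
      using rank_submodular[of "insert e X" Y] eE assms by auto
    moreover have "\<rho> Y \<le> \<rho> (insert e Y)" using rank_mono[of Y "insert e Y"] eE assms by auto
    ultimately show ?thesis using r eE by (auto simp: cl_def)
  qed
qed

lemma rank_Un_cl:
  assumes "X \<subseteq> E" "finite S" "S \<subseteq> cl E \<rho> X" shows "\<rho> (X \<union> S) = \<rho> X"
  using assms(2,3)
proof (induction S rule: finite_induct)
  case (insert e S)
  have sE: "S \<subseteq> E" using insert.prems cl_subset by blast
  have "e \<in> cl E \<rho> (X \<union> S)" using insert.prems cl_mono[of X "X \<union> S"] sE assms(1) by auto
  then show ?case using insert by (auto simp: cl_def)
qed simp

lemma rank_cl: "X \<subseteq> E \<Longrightarrow> \<rho> (cl E \<rho> X) = \<rho> X"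
  using rank_Un_cl[of X "cl E \<rho> X"] subset_cl[of X] cl_subset[of X]
    finite_subset[OF _ finite_ground, of "cl E \<rho> X"] by (simp add: Un_absorb1)

lemma cl_cl:
  assumes "X \<subseteq> E" shows "cl E \<rho> (cl E \<rho> X) = cl E \<rho> X"
proof
  show "cl E \<rho> (cl E \<rho> X) \<subseteq> cl E \<rho> X"
  proof
    fix e assume e: "e \<in> cl E \<rho> (cl E \<rho> X)"
    then have eE: "e \<in> E" and "\<rho> (insert e (cl E \<rho> X)) = \<rho> X"
      using rank_cl[OF assms] by (auto simp: cl_def)
    moreover have "\<rho> (insert e X) \<le> \<rho> (insert e (cl E \<rho> X))"
      using eE cl_subset subset_cl[OF assms] by (intro rank_mono) auto
    moreover have "\<rho> X \<le> \<rho> (insert e X)" using eE assms by (intro rank_mono) auto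
    ultimately show "e \<in> cl E \<rho> X" by (auto simp: cl_def)
  qed
qed (simp add: subset_cl cl_subset)

lemma cyc_subset: "cyc \<rho> X \<subseteq> X"
  by (auto simp: cyc_def)

lemma cyc_mono:
  assumes "X \<subseteq> Y" "Y \<subseteq> E" shows "cyc \<rho> X \<subseteq> cyc \<rho> Y"
proof
  fix e assume "e \<in> cyc \<rho> X"
  then have e: "e \<in> X" and r: "\<rho> (X - {e}) = \<rho> X" by (auto simp: cyc_def)
  have "X \<union> (Y - {e}) = Y" "X \<inter> (Y - {e}) = X - {e}" using e assms by auto
  then have "\<rho> Y + \<rho> (X - {e}) \<le> \<rho> X + \<rho> (Y - {e})"
    using rank_submodular[of X "Y - {e}"] assms by auto
  moreover have "\<rho> (Y - {e}) \<le> \<rho> Y" using assms by (intro rank_mono) auto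
  ultimately show "e \<in> cyc \<rho> Y" using r e assms by (auto simp: cyc_def)
qed

lemma cyc_remove:
  assumes "F \<subseteq> E" "f \<in> F" "f \<notin> cyc \<rho> F" shows "cyc \<rho> (F - {f}) = cyc \<rho> F"
proof
  show "cyc \<rho> (F - {f}) \<subseteq> cyc \<rho> F" using assms by (intro cyc_mono) auto
  show "cyc \<rho> F \<subseteq> cyc \<rho> (F - {f})"
  proof
    fix e assume eF: "e \<in> cyc \<rho> F"
    then have e: "e \<in> F" "e \<noteq> f" and r: "\<rho> (F - {e}) = \<rho> F" using assms by (auto simp: cyc_def)
    have lt: "\<rho> (F - {f}) < \<rho> F"
      using assms rank_mono[of "F - {f}" F] by (auto simp: cyc_def)
    have "(F - {f} - {e}) \<union> {f} = F - {e}" "(F - {f} - {e}) \<inter> {f} = {}" using e assms by auto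
    then have "\<rho> (F - {e}) \<le> \<rho> (F - {f} - {e}) + \<rho> {f}"
      using rank_submodular[of "F - {f} - {e}" "{f}"] assms(1,2) by (simp add: subset_iff)
    moreover have "\<rho> {f} \<le> 1" using rank_le_card[of "{f}"] assms by auto
    moreover have "\<rho> (F - {f} - {e}) \<le> \<rho> (F - {f})" using assms by (intro rank_mono) auto
    ultimately have "\<rho> (F - {f} - {e}) = \<rho> (F - {f})" using lt r by linarith
    then show "e \<in> cyc \<rho> (F - {f})" using e by (auto simp: cyc_def)
  qed
qed

lemma cyc_cyc:
  assumes "F \<subseteq> E" shows "cyc \<rho> (cyc \<rho> F) = cyc \<rho> F"
proof -
  have "cyc \<rho> (F - S) = cyc \<rho> F" if "finite S" "S \<subseteq> F - cyc \<rho> F" for S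
    using that
  proof (induction S rule: finite_induct)
    case (insert f S)
    have "cyc \<rho> (F - S - {f}) = cyc \<rho> (F - S)"
      using insert assms by (intro cyc_remove) auto
    moreover have "F - insert f S = F - S - {f}" by auto
    ultimately show ?case using insert by simp
  qed simp
  from this[of "F - cyc \<rho> F"] have "cyc \<rho> (F - (F - cyc \<rho> F)) = cyc \<rho> F"
    using finite_subset[OF assms finite_ground] by auto
  moreover have "F - (F - cyc \<rho> F) = cyc \<rho> F" using cyc_subset[of F] by auto
  ultimately show ?thesis by simp
qed

lemma cyclic_flat_cl_Union:
  assumes "\<And>X. X \<in> A \<Longrightarrow> cyclic_flat E \<rho> X" shows "cyclic_flat E \<rho> (cl E \<rho> (\<Union>A))"
proof -
  have U: "\<Union>A \<subseteq> E" using assms by (auto simp: cyclic_flat_def)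
  have "e \<in> cyc \<rho> (cl E \<rho> (\<Union>A))" if e: "e \<in> cl E \<rho> (\<Union>A)" for e
  proof (cases "e \<in> \<Union>A")
    case True
    then obtain X where X: "X \<in> A" "e \<in> X" by auto
    then have "e \<in> cyc \<rho> X" using assms by (auto simp: cyclic_flat_def)
    moreover have "X \<subseteq> cl E \<rho> (\<Union>A)" using X subset_cl[OF U] by auto
    ultimately show ?thesis using cyc_mono cl_subset by blast
  next
    case False
    have "\<rho> (\<Union>A) \<le> \<rho> (cl E \<rho> (\<Union>A) - {e})"
      using False subset_cl[OF U] cl_subset[of "\<Union>A"] by (intro rank_mono) auto
    moreover have "\<rho> (cl E \<rho> (\<Union>A) - {e}) \<le> \<rho> (cl E \<rho> (\<Union>A))"
      using cl_subset[of "\<Union>A"] by (intro rank_mono) auto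
    ultimately show ?thesis using e rank_cl[OF U] by (auto simp: cyc_def)
  qed
  then show ?thesis
    using cl_cl[OF U] cl_subset[of "\<Union>A"] cyc_subset[of "cl E \<rho> (\<Union>A)"] by (auto simp: cyclic_flat_def)
qed

lemma cyclic_flat_cyc:
  assumes "F \<subseteq> E" "cl E \<rho> F = F" shows "cyclic_flat E \<rho> (cyc \<rho> F)"
proof -
  have "e \<in> cyc \<rho> F" if e: "e \<in> cl E \<rho> (cyc \<rho> F)" for e
  proof (rule ccontr)
    assume n: "e \<notin> cyc \<rho> F"
    have eF: "e \<in> F" using e cl_mono[OF cyc_subset assms(1)] assms(2) by auto
    have "cyc \<rho> F \<subseteq> F - {e}" using n cyc_subset by auto
    then have "e \<in> cl E \<rho> (F - {e})" using e cl_mono[of "cyc \<rho> F" "F - {e}"] assms(1) by auto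
    then show False using n eF by (auto simp: cl_def cyc_def insert_absorb)
  qed
  moreover have "cyc \<rho> F \<subseteq> E" using cyc_subset assms(1) by blast
  ultimately show ?thesis
    using subset_cl cyc_cyc[OF assms(1)] by (auto simp: cyclic_flat_def)
qed

lemma cl_Inter_flats:
  assumes "\<And>X. X \<in> A \<Longrightarrow> cyclic_flat E \<rho> X" shows "cl E \<rho> (E \<inter> \<Inter>A) = E \<inter> \<Inter>A"
proof -
  have "cl E \<rho> (E \<inter> \<Inter>A) \<subseteq> X" if "X \<in> A" for X
    using cl_mono[of "E \<inter> \<Inter>A" X] assms[OF that] that by (auto simp: cyclic_flat_def)
  then show ?thesis using subset_cl[of "E \<inter> \<Inter>A"] cl_subset[of "E \<inter> \<Inter>A"] by blast
qed

lemma lub_cyclic_flats: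
  assumes "\<And>X. X \<in> A \<Longrightarrow> cyclic_flat E \<rho> X"
  shows "is_lub (cyclic_flats E \<rho>) (cl E \<rho> (\<Union>A)) A"
proof -
  have U: "\<Union>A \<subseteq> E" using assms by (auto simp: cyclic_flat_def)
  have "cl E \<rho> (\<Union>A) \<subseteq> Y" if "cyclic_flat E \<rho> Y" "\<forall>X\<in>A. X \<subseteq> Y" for Y
    using cl_mono[of "\<Union>A" Y] that by (auto simp: cyclic_flat_def)
  then show ?thesis
    using assms cyclic_flat_cl_Union[of A] subset_cl[OF U]
    by (auto simp: least_def Upper_def cyclic_flats_def)
qed

lemma glb_cyclic_flats:
  assumes "\<And>X. X \<in> A \<Longrightarrow> cyclic_flat E \<rho> X"
  shows "is_glb (cyclic_flats E \<rho>) (cyc \<rho> (E \<inter> \<Inter>A)) A"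
proof -
  have "Y \<subseteq> cyc \<rho> (E \<inter> \<Inter>A)" if "cyclic_flat E \<rho> Y" "\<forall>X\<in>A. Y \<subseteq> X" for Y
    using cyc_mono[of Y "E \<inter> \<Inter>A"] that by (auto simp: cyclic_flat_def)
  then show ?thesis
    using assms cyclic_flat_cyc[OF _ cl_Inter_flats[of A]] cyc_subset[of "E \<inter> \<Inter>A"]
    by (auto simp: greatest_def Lower_def cyclic_flats_def)
qed

theorem complete_lattice_cyclic_flats: "complete_lattice (cyclic_flats E \<rho>)"
proof
  fix A assume "A \<subseteq> carrier (cyclic_flats E \<rho>)"
  then have "\<And>X. X \<in> A \<Longrightarrow> cyclic_flat E \<rho> X" by (auto simp: cyclic_flats_def)
  from lub_cyclic_flats[OF this] glb_cyclic_flats[OF this]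
  show "\<exists>s. is_lub (cyclic_flats E \<rho>) s A" "\<exists>i. is_glb (cyclic_flats E \<rho>) i A"
    by auto
qed (auto simp: cyclic_flats_def)

lemma sup_cyclic_flats:
  assumes "\<And>X. X \<in> A \<Longrightarrow> cyclic_flat E \<rho> X"
  shows "\<Squnion>\<^bsub>cyclic_flats E \<rho>\<^esub>A = cl E \<rho> (\<Union>A)"
proof -
  have l: "is_lub (cyclic_flats E \<rho>) (cl E \<rho> (\<Union>A)) A"
    by (rule lub_cyclic_flats) (rule assms)
  then have "Y = cl E \<rho> (\<Union>A)" if "is_lub (cyclic_flats E \<rho>) Y A" for Y
    using that by (auto simp: least_def cyclic_flats_def)
  then show ?thesis
    unfolding sup_def using l by (intro some_equality)
qed

lemma inf_cyclic_flats:
  assumes "\<And>X. X \<in> A \<Longrightarrow> cyclic_flat E \<rho> X"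
  shows "\<Sqinter>\<^bsub>cyclic_flats E \<rho>\<^esub>A = cyc \<rho> (E \<inter> \<Inter>A)"
proof -
  have g: "is_glb (cyclic_flats E \<rho>) (cyc \<rho> (E \<inter> \<Inter>A)) A"
    by (rule glb_cyclic_flats) (rule assms)
  then have "Y = cyc \<rho> (E \<inter> \<Inter>A)" if "is_glb (cyclic_flats E \<rho>) Y A" for Y
    using that by (auto simp: greatest_def cyclic_flats_def)
  then show ?thesis
    unfolding inf_def using g by (intro some_equality)
qed

theorem join_cyclic_flats:
  assumes "cyclic_flat E \<rho> X" "cyclic_flat E \<rho> Y"
  shows "X \<squnion>\<^bsub>cyclic_flats E \<rho>\<^esub> Y = cl E \<rho> (X \<union> Y)"
  using sup_cyclic_flats[of "{X, Y}"] assms by (auto simp: join_def)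

theorem meet_cyclic_flats:
  assumes "cyclic_flat E \<rho> X" "cyclic_flat E \<rho> Y"
  shows "X \<sqinter>\<^bsub>cyclic_flats E \<rho>\<^esub> Y = cyc \<rho> (X \<inter> Y)"
proof -
  have "E \<inter> (X \<inter> Y) = X \<inter> Y" using assms by (auto simp: cyclic_flat_def)
  then show ?thesis using inf_cyclic_flats[of "{X, Y}"] assms by (auto simp: meet_def)
qed

theorem bottom_cyclic_flats: "\<bottom>\<^bsub>cyclic_flats E \<rho>\<^esub> = cl E \<rho> {}"
proof -
  have "Upper (cyclic_flats E \<rho>) {} = carrier (cyclic_flats E \<rho>)" by (auto simp: Upper_def)
  then show ?thesis using sup_cyclic_flats[of "{}"] by (auto simp: bottom_def sup_def)
qed

end

end

theory Submission
  imports Defs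
begin

text \<open>Over \<open>bit\<close>, a set of columns contains a circuit through \<open>e\<close> iff it has a zero-sum subset
  through \<open>e\<close>. Given \<open>e\<close> in a cyclic flat \<open>X\<close>, choose a zero-sum \<open>C \<subseteq> X\<close> through \<open>e\<close> of
  minimal cardinality. If some \<open>f \<notin> C\<close> were in the closure of \<open>C\<close>, it would be a chord: it would
  split \<open>C\<close> into two zero-sum sets \<open>insert f A\<close> and \<open>insert f (C - A)\<close>, and by simplicity the one
  through \<open>e\<close> would be smaller than \<open>C\<close>. So \<open>C\<close> is a flat, and as a circuit it is an atom. Hence \<open>X\<close>
  is even the union of the atoms below it.\<close>

section \<open>Linear algebra over the two-element field\<close>

text \<open>If \<open>a\<close> lay outside the span, a basis of \<open>S\<close> together with
  \<open>a\<close> would be a basis of \<open>insert a S\<close> with one more element.\<close>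

lemma (in vector_space) dim_insert_eq_iff:
  assumes "finite S"
  shows "dim (insert a S) = dim S \<longleftrightarrow> a \<in> span S"
proof
  assume eq: "dim (insert a S) = dim S"
  obtain B where B: "B \<subseteq> S" "independent B" "S \<subseteq> span B" "card B = dim S"
    by (rule basis_exists)
  have fin: "finite B" using B(1) assms by (rule finite_subset)
  show "a \<in> span S"
  proof (rule ccontr)
    assume a: "a \<notin> span S"
    then have aB: "a \<notin> span B" using span_mono[OF B(1)] by auto
    then have "a \<notin> B" by (auto intro: span_base)
    have "card (insert a B) = dim (insert a S)"
    proof (rule basis_card_eq_dim)
      show "independent (insert a B)" using aB B(2) by (rule independent_insertI)
      show "insert a S \<subseteq> span (insert a B)"
        using B(3) span_mono[of B "insert a B"] by (auto intro: span_base)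
    qed (use B in auto)
    with \<open>a \<notin> B\<close> fin B(4) eq show False by simp
  qed
next
  assume "a \<in> span S"
  then show "dim (insert a S) = dim S"
    by (intro span_eq_dim span_redundant)
qed

text \<open>Characteristic 2: every vector is its own negative, so terms cross an equation without a
  sign.\<close>

lemma bit_fun_add_self: "x + x = (0 :: nat \<Rightarrow> bit)"
  by (simp add: fun_eq_iff flip: mult_2)

lemma bit_fun_add_eq_0_iff: "x + y = 0 \<longleftrightarrow> x = (y :: nat \<Rightarrow> bit)"
  by (metis add.assoc add_0 add_0_right bit_fun_add_self)

text \<open>The only scalars are 0 and 1, so a linear combination amounts to the set of indices with
  coefficient 1. Summing over indices rather than vectors allows repeated columns.\<close>

lemma span_image_bit_iff:
  fixes v :: "'a \<Rightarrow> nat \<Rightarrow> bit"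
  assumes "finite X"
  shows "x \<in> module.span fun_scale (v ` X) \<longleftrightarrow> (\<exists>A\<subseteq>X. x = sum v A)"
proof -
  interpret fs: vector_space "fun_scale :: bit \<Rightarrow> _" by (rule vector_space_fun_scale)
  show ?thesis
  proof
    assume "x \<in> fs.span (v ` X)"
    with assms show "\<exists>A\<subseteq>X. x = sum v A"
    proof (induction X arbitrary: x rule: finite_induct)
      case (insert e X)
      then obtain k where "x - fun_scale k (v e) \<in> fs.span (v ` X)"
        using fs.span_breakdown_eq by auto
      then obtain A where A: "A \<subseteq> X" "x - fun_scale k (v e) = sum v A"
        using insert.IH by blast
      have fin: "finite A" "e \<notin> A" using A insert.hyps finite_subset by auto
      show ?case
      proof (cases "k = 0")
        case True
        then show ?thesis using A by auto
      next
        \<comment> \<open>The only nonzero scalar is 1, so \<open>v e\<close> itself is the extra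
          summand.\<close>
        case False
        then have "x = v e + sum v A" using A by (simp add: algebra_simps)
        then show ?thesis using fin A(1) by (intro exI[of _ "insert e A"]) auto
      qed
    qed simp
  next
    assume "\<exists>A\<subseteq>X. x = sum v A"
    then show "x \<in> fs.span (v ` X)"
      by (auto intro!: fs.span_sum intro: fs.span_base)
  qed
qed

section \<open>Rank, cyclic part and closure in terms of zero sums\<close>

locale binary_representation = matroid E \<rho>
  for E :: "'a set" and \<rho> :: "'a set \<Rightarrow> nat" and v :: "'a \<Rightarrow> nat \<Rightarrow> bit" +
  assumes rank_eq_dim: "X \<subseteq> E \<Longrightarrow> \<rho> X = vector_space.dim fun_scale (v ` X)"
begin

lemma rank_insert_eq_iff:
  assumes "X \<subseteq> E" "e \<in> E"
  shows "\<rho> (insert e X) = \<rho> X \<longleftrightarrow> (\<exists>A\<subseteq>X. v e = sum v A)"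
proof -
  interpret fs: vector_space "fun_scale :: bit \<Rightarrow> _" by (rule vector_space_fun_scale)
  have fin: "finite X" using assms(1) finite_ground by (rule finite_subset)
  show ?thesis
    using assms rank_eq_dim[of X] rank_eq_dim[of "insert e X"]
      fs.dim_insert_eq_iff[of "v ` X" "v e"] span_image_bit_iff[OF fin] fin
    by simp
qed

text \<open>Moving \<open>v e\<close> across turns \<open>v e = sum v A\<close> into a zero sum over
  \<open>insert e A\<close>. The zero-sum sets form the cycle space: they are the disjoint unions of
  circuits.\<close>

lemma cyc_iff_zero_sum:
  assumes "X \<subseteq> E"
  shows "e \<in> cyc \<rho> X \<longleftrightarrow> (\<exists>C\<subseteq>X. e \<in> C \<and> sum v C = 0)"
proof -
  have fin: "finite A" if "A \<subseteq> X" for A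
    using that assms finite_ground by (meson finite_subset)
  have rank: "\<rho> (X - {e}) = \<rho> X \<longleftrightarrow> (\<exists>A\<subseteq>X - {e}. v e = sum v A)" if "e \<in> X"
  proof -
    have "insert e (X - {e}) = X" "X - {e} \<subseteq> E" "e \<in> E" using that assms by auto
    then show ?thesis using rank_insert_eq_iff[of "X - {e}" e] by metis
  qed
  have "(\<exists>A\<subseteq>X - {e}. v e = sum v A) \<longleftrightarrow> (\<exists>C\<subseteq>X. e \<in> C \<and> sum v C = 0)" if "e \<in> X"
  proof
    assume "\<exists>A\<subseteq>X - {e}. v e = sum v A"
    then obtain A where A: "A \<subseteq> X - {e}" "v e = sum v A" by blast
    then have "sum v (insert e A) = v e + sum v A" using fin[of A] by (subst sum.insert) auto
    then show "\<exists>C\<subseteq>X. e \<in> C \<and> sum v C = 0"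
      using A that by (intro exI[of _ "insert e A"]) (auto simp: bit_fun_add_self)
  next
    assume "\<exists>C\<subseteq>X. e \<in> C \<and> sum v C = 0"
    then obtain C where C: "C \<subseteq> X" "e \<in> C" "sum v C = 0" by blast
    then have "v e + sum v (C - {e}) = 0" using fin[of C] by (simp flip: sum.remove)
    then show "\<exists>A\<subseteq>X - {e}. v e = sum v A"
      using C by (intro exI[of _ "C - {e}"]) (auto simp: bit_fun_add_eq_0_iff)
  qed
  then show ?thesis using rank unfolding cyc_def by blast
qed

text \<open>Because \<open>e\<close> lies outside \<open>X\<close>, it contributes a separate
  summand to \<open>insert e A\<close>, and the zero sum says that \<open>v e\<close> is spanned by
  \<open>X\<close>.\<close>

lemma cl_iff_zero_sum:
  assumes "X \<subseteq> E" "e \<in> E" "e \<notin> X"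
  shows "e \<in> cl E \<rho> X \<longleftrightarrow> (\<exists>A\<subseteq>X. sum v (insert e A) = 0)"
proof -
  have "sum v (insert e A) = v e + sum v A" if "A \<subseteq> X" for A
    using that assms finite_subset[of A E] finite_ground by (subst sum.insert) auto
  then show ?thesis
    using rank_insert_eq_iff[of X e] assms by (simp add: cl_def bit_fun_add_eq_0_iff cong: conj_cong)
qed

text \<open>The two parts add up to 0 and hence agree. This allows either part of a split zero-sum
  set to be exchanged for the other.\<close>

lemma sum_Diff_zero_sum:
  assumes "C \<subseteq> E" "sum v C = 0" "A \<subseteq> C"
  shows "sum v (C - A) = sum v A"
proof -
  have "sum v (C - A) + sum v A = 0"
    using assms sum.subset_diff[of A C v] finite_subset[of C E] finite_ground by simp
  then show ?thesis by (simp add: bit_fun_add_eq_0_iff)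
qed

lemma vec_nonzero:
  assumes "simple_matroid E \<rho>" "e \<in> E"
  shows "v e \<noteq> 0"
proof
  assume "v e = 0"
  \<comment> \<open>The zero column is the empty sum, so \<open>e\<close> is spanned by the empty
    set.\<close>
  then have "\<rho> {e} = \<rho> {}" using rank_insert_eq_iff[of "{}" e] assms(2) by simp
  then have "loop E \<rho> e" using rank_le_card[of "{}"] assms(2) by (simp add: loop_def)
  then show False using assms(1) by (simp add: simple_matroid_def)
qed

lemma vec_inj_on:
  assumes "simple_matroid E \<rho>"
  shows "inj_on v E"
proof (rule inj_onI, rule ccontr)
  fix e f assume ef: "e \<in> E" "f \<in> E" "v e = v f" "e \<noteq> f"
  have nl: "\<not> loop E \<rho> e" "\<not> loop E \<rho> f" using assms by (auto simp: simple_matroid_def)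
  have "\<rho> {e, f} = \<rho> {f}"
    using rank_insert_eq_iff[of "{f}" e] ef by (auto intro: exI[of _ "{f}"])
  also have "\<rho> {f} = 1"
    using nl(2) rank_le_card[of "{f}"] ef by (simp add: loop_def)
  finally have "parallel E \<rho> e f" using nl ef by (simp add: parallel_def)
  then show False using assms by (auto simp: simple_matroid_def)
qed

lemma cl_empty:
  assumes "simple_matroid E \<rho>"
  shows "cl E \<rho> {} = {}"
  using cl_iff_zero_sum[of "{}"] vec_nonzero[OF assms] cl_subset[of "{}"] by auto

section \<open>Atoms from minimal zero-sum sets\<close>

text \<open>A nonempty cyclic flat contains a nonempty zero-sum set, so by minimality none fits
  strictly inside \<open>C\<close>. Simplicity makes the empty set the bottom element.\<close>

lemma zero_sum_flat_is_atom:
  assumes "simple_matroid E \<rho>" and C: "C \<subseteq> E" "C \<noteq> {}" "sum v C = 0" "cl E \<rho> C = C"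
    and minimal: "\<And>B. B \<subset> C \<Longrightarrow> sum v B = 0 \<Longrightarrow> B = {}"
  shows "C \<in> atoms (cyclic_flats E \<rho>)"
proof -
  have "cyc \<rho> C = C" using cyc_iff_zero_sum[OF C(1)] C(3) cyc_subset by blast
  then have "cyclic_flat E \<rho> C" using C by (simp add: cyclic_flat_def)
  moreover have "cyclic_flat E \<rho> {}"
    using cl_empty[OF assms(1)] by (simp add: cyclic_flat_def cyc_def)
  moreover have "Z = {}" if Z: "cyclic_flat E \<rho> Z" "Z \<subset> C" for Z
  proof (rule ccontr)
    assume "Z \<noteq> {}"
    then obtain g where g: "g \<in> Z" by blast
    then have "g \<in> cyc \<rho> Z" "Z \<subseteq> E" using Z(1) by (auto simp: cyclic_flat_def)
    then obtain B where "B \<subseteq> Z" "g \<in> B" "sum v B = 0" using cyc_iff_zero_sum[of Z g] by auto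
    then show False using minimal[of B] Z(2) by blast
  qed
  moreover have "\<bottom>\<^bsub>cyclic_flats E \<rho>\<^esub> = {}"
    using bottom_cyclic_flats cl_empty[OF assms(1)] by simp
  ultimately show ?thesis
    using C(2) by (auto simp: atoms_def covers_def lless_def cyclic_flats_def)
qed

lemma exists_atom_through:
  assumes simple: "simple_matroid E \<rho>" and X: "cyclic_flat E \<rho> X" and e: "e \<in> X"
  obtains C where "C \<in> atoms (cyclic_flats E \<rho>)" "e \<in> C" "C \<subseteq> X"
proof -
  have XE: "X \<subseteq> E" "cl E \<rho> X = X" "cyc \<rho> X = X" using X by (auto simp: cyclic_flat_def)
  define P where "P C \<longleftrightarrow> C \<subseteq> X \<and> e \<in> C \<and> sum v C = 0" for C
  have "\<exists>C. P C" using cyc_iff_zero_sum[OF XE(1), of e] XE(3) e by (auto simp: P_def)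
  then obtain C where "P C" and least: "\<And>B. P B \<Longrightarrow> card C \<le> card B"
    using ex_has_least_nat[of P _ card] by blast
  then have C: "C \<subseteq> X" "e \<in> C" "sum v C = 0" by (auto simp: P_def)
  have CE: "C \<subseteq> E" and fin: "finite C"
    using C(1) XE(1) finite_subset[OF _ finite_ground] by auto
  \<comment> \<open>Minimality among zero-sum sets through \<open>e\<close> extends to all nonempty
    ones: if \<open>B\<close> avoids \<open>e\<close>, then \<open>C - B\<close> is a competitor
    through \<open>e\<close>.\<close>
  have minimal: "B = {}" if B: "B \<subset> C" "sum v B = 0" for B
  proof (cases "e \<in> B")
    case True
    then have "P B" using B C by (auto simp: P_def)
    then show ?thesis using least[of B] psubset_card_mono[OF fin B(1)] by simp
  next
    case False
    then have "P (C - B)"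
      using B C sum_Diff_zero_sum[OF CE C(3), of B] by (auto simp: P_def)
    then have "C - B = C" using least[of "C - B"] fin by (intro card_seteq) auto
    then show ?thesis using B(1) by blast
  qed
  have "cl E \<rho> C \<subseteq> C"
  proof (rule subsetI, rule ccontr)
    fix f assume f: "f \<in> cl E \<rho> C" "f \<notin> C"
    then have fX: "f \<in> X" using cl_mono[OF C(1) XE(1)] XE(2) by auto
    then have fE: "f \<in> E" using XE(1) by auto
    have vf: "sum v (insert f A) = v f + sum v A" if "A \<subseteq> C" for A
      using that f(2) finite_subset[OF that fin] by (subst sum.insert) auto
    obtain A0 where A0: "A0 \<subseteq> C" "v f = sum v A0"
      using f fE cl_iff_zero_sum[OF CE] vf by (auto simp: bit_fun_add_eq_0_iff)
    \<comment> \<open>Both \<open>A0\<close> and \<open>C - A0\<close> sum to \<open>v f\<close>.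
      The one containing \<open>e\<close> is taken, so that \<open>insert f A\<close> competes with
      \<open>C\<close>.\<close>
    define A where "A = (if e \<in> A0 then A0 else C - A0)"
    have A: "A \<subseteq> C" "e \<in> A" "v f = sum v A"
      using A0 C sum_Diff_zero_sum[OF CE C(3) A0(1)] by (auto simp: A_def)
    have "P (insert f A)"
      using A C fX vf[OF A(1)] by (auto simp: P_def bit_fun_add_self)
    then have "card C \<le> card (insert f A)" by (rule least)
    also have "\<dots> = Suc (card A)"
      using A(1) f(2) finite_subset[OF A(1) fin] by (intro card_insert_disjoint) auto
    \<comment> \<open>Adding the single element \<open>f\<close> to \<open>A\<close> already reaches
      the size of \<open>C\<close>, so \<open>A\<close> misses at most one element of
      \<open>C\<close>.\<close>
    finally have "card (C - A) \<le> 1"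
      using A(1) fin by (simp add: card_Diff_subset finite_subset)
    then consider "C - A = {}" | g where "C - A = {g}"
      using fin by (metis card_1_singletonE card_eq_0_iff finite_Diff le_neq_implies_less less_one)
    \<comment> \<open>The remainder \<open>C - A\<close> also sums to \<open>v f\<close>: if empty
      it makes \<open>f\<close> a loop, and if it is \<open>{g}\<close> it makes \<open>f\<close>
      parallel to \<open>g\<close>.\<close>
    then show False
    proof cases
      case 1
      then have "v f = 0" using A sum_Diff_zero_sum[OF CE C(3) A(1)] by simp
      then show False using vec_nonzero[OF simple fE] by simp
    next
      case 2
      then have "v f = v g" "g \<in> C"
        using A sum_Diff_zero_sum[OF CE C(3) A(1)] by auto
      then show False using vec_inj_on[OF simple] fE CE f(2) by (auto dest: inj_onD)
    qed
  qed
  then have "cl E \<rho> C = C" using subset_cl[OF CE] by auto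
  then have "C \<in> atoms (cyclic_flats E \<rho>)"
    using zero_sum_flat_is_atom[OF simple CE _ C(3)] minimal C(2) by blast
  then show ?thesis using that C by blast
qed

lemma atomic_lattice_cyclic_flats:
  assumes "simple_matroid E \<rho>"
  shows "atomic_lattice (cyclic_flats E \<rho>)"
  unfolding atomic_lattice_def
proof
  fix X assume "X \<in> carrier (cyclic_flats E \<rho>)"
  then have X: "cyclic_flat E \<rho> X" by (simp add: cyclic_flats_def)
  define A where "A = {C \<in> atoms (cyclic_flats E \<rho>). C \<subseteq> X}"
  have "e \<in> \<Union>A" if "e \<in> X" for e
    using exists_atom_through[OF assms X that] by (auto simp: A_def)
  then have "\<Union>A = X" by (auto simp: A_def)
  moreover have "cyclic_flat E \<rho> C" if "C \<in> A" for C
    using that by (auto simp: A_def atoms_def covers_def cyclic_flats_def)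
  moreover have "A \<subseteq> atoms (cyclic_flats E \<rho>)" by (auto simp: A_def)
  \<comment> \<open>The join of \<open>A\<close> is the closure of its union \<open>X\<close>, and
    \<open>X\<close> is closed.\<close>
  ultimately have "A \<subseteq> atoms (cyclic_flats E \<rho>) \<and> X = \<Squnion>\<^bsub>cyclic_flats E \<rho>\<^esub>A"
    using X sup_cyclic_flats[of A] by (simp add: cyclic_flat_def)
  then show "\<exists>A\<subseteq>atoms (cyclic_flats E \<rho>). X = \<Squnion>\<^bsub>cyclic_flats E \<rho>\<^esub>A"
    by (rule exI)
qed

end

theorem theorem7p8:
  fixes E :: "'a set" and \<rho> :: "'a set \<Rightarrow> nat"
  assumes "matroid E \<rho>"
    and "simple_matroid E \<rho>"
    and "binary_matroid E \<rho>"
    and "\<nexists>e. isthmus E \<rho> e"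
  shows "atomic_lattice (cyclic_flats E \<rho>)"
proof -
  obtain v :: "'a \<Rightarrow> nat \<Rightarrow> bit"
    where "\<forall>X\<subseteq>E. \<rho> X = vector_space.dim fun_scale (v ` X)"
    using assms(3) by (auto simp: binary_matroid_def representable_over_def)
  then interpret binary_representation E \<rho> v
    using assms(1) by (simp add: binary_representation_def binary_representation_axioms_def)
  show ?thesis by (rule atomic_lattice_cyclic_flats) (rule assms(2))
qed

end
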